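(* Let $\lVert\cdot\rVert_A$ be a rearrangement-invariant quasi-Banach function norm over $([0,\infty),\lambda)$ and assume that the Hardy--Littlewood--Pólya principle holds for $\lVert\cdot\rVert_A$. Then the global component of $\lVert\cdot\rVert_{L^1}$ is stronger than that of $\lVert\cdot\rVert_A$; that is, for every $f\in M$ with $f^*(1)<\infty$, $\lVert f^*\chi_{(1,\infty)}\rVert_{L^1}<\infty$ implies $\lVert f^*\chi_{(1,\infty)}\rVert_A<\infty$.
   Context: $\lambda$ is Lebesgue measure on $[0,\infty)$; $M$ is the set of extended complex-valued $\lambda$-measurable functions on $[0,\infty)$ (identified when equal a.e.), $M_+$ the non-negative ones. The non-increasing rearrangement of $f\in M$ is $f^*(t)=\inf\{s\ge 0:\lambda(\{|f|>s\})\le t\}$. A quasi-Banach function norm is a map $\lVert\cdot\rVert:M\to[0,\infty]$ with $\lVert\,|f|\,\rVert=\lVert f\rVert$ whose restriction to $M_+$ satisfies: (Q1) it is positively homogeneous, $\lVert f\rVert=0\Leftrightarrow f=0$ a.e., and there is a constant $C\ge1$ with $\lVert f+g\rVert\le C(\lVert f\rVert+\lVert g\rVert)$; (P2) $f\le g$ a.e. implies $\lVert f\rVert\le\lVert g\rVert$; (P3) $f_n\uparrow f$ a.e. implies $\lVert f_n\rVert\uparrow\lVert f\rVert$; (P4) $\lVert\chi_E\rVert<\infty$ whenever $\lambda(E)<\infty$. It is rearrangement-invariant (r.i.) if $f^*=g^*$ implies $\lVert f\rVert=\lVert g\rVert$. The Hardy--Littlewood--Pólya principle holds for $\lVert\cdot\rVert_A$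 if $\lVert f\rVert_A\le\lVert g\rVert_A$ for every pair $f,g\in M$ satisfying $\int_0^tf^*\,d\lambda\le\int_0^tg^*\,d\lambda$ for all $t\in(0,\infty)$. *)

theory Defs
  imports "HOL-Analysis.Analysis"
begin

abbreviation half_line :: "real measure" where
  "half_line \<equiv> lebesgue_on {0..}"

text \<open>The extended complex numbers are the one-point compactification of the complex plane, with
  \<^term>\<open>None\<close> as the point at infinity.\<close>

type_synonym ecomplex = "complex option"

definition ecomplex_borel :: "ecomplex measure" where
  "ecomplex_borel = sigma UNIV {U. openin (Alexandroff_compactification euclidean) U}"

definition emod :: "ecomplex \<Rightarrow> ennreal" where
  "emod z = (case z of None \<Rightarrow> \<infinity> | Some w \<Rightarrow> ennreal (cmod w))"

definition ecomplex_of_ennreal :: "ennreal \<Rightarrow> ecomplex" where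
  "ecomplex_of_ennreal r = (if r = \<infinity> then None else Some (complex_of_real (enn2real r)))"

text \<open>Functions are total on the reals; their values on the negative half-line are irrelevant.
  Functions equal a.e. are not identified here; that norms do not distinguish such
  functions is shown in \<open>quasi_Banach_function_norm_cong_AE\<close>.\<close>

definition \<M> :: "(real \<Rightarrow> ecomplex) set" where
  "\<M> = half_line \<rightarrow>\<^sub>M ecomplex_borel"

text \<open>Non-negative functions are represented by their \<^typ>\<open>ennreal\<close>-valued versions, and enter
  \<^term>\<open>\<M>\<close> through the following embedding.\<close>

definition \<M>_plus :: "(real \<Rightarrow> ennreal) set" where
  "\<M>_plus = borel_measurable half_line"

definition of_M_plus :: "(real \<Rightarrow> ennreal) \<Rightarrow> (real \<Rightarrow> ecomplex)" where
  "of_M_plus g = (\<lambda>x. ecomplex_of_ennreal (g x))"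

text \<open>The infimum is that of a set of finite numbers in \<open>[0,\<infinity>]\<close>; it is \<open>\<infinity>\<close> if the set is empty.
  The rearrangement is only meaningful for arguments \<open>t \<ge> 0\<close>.\<close>

definition rearrangement :: "(real \<Rightarrow> ecomplex) \<Rightarrow> real \<Rightarrow> ennreal" where
  "rearrangement f t =
     Inf {ennreal s | s. 0 \<le> s \<and>
            emeasure half_line {x \<in> space half_line. emod (f x) > ennreal s} \<le> ennreal t}"

text \<open>Norms are maps on all functions, but they are only constrained on \<^term>\<open>\<M>\<close>.  In the
  homogeneity law the case \<open>a = 0\<close> uses the convention \<open>0 \<sqdot> \<infinity> = 0\<close> of \<^typ>\<open>ennreal\<close>.\<close>

definition quasi_Banach_function_norm :: "((real \<Rightarrow> ecomplex) \<Rightarrow> ennreal) \<Rightarrow> bool" where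
  "quasi_Banach_function_norm N \<longleftrightarrow>
     (\<forall>f\<in>\<M>. N (of_M_plus (\<lambda>x. emod (f x))) = N f) \<and>
     \<comment> \<open>(Q1)\<close>
     (\<forall>a\<ge>0. \<forall>f\<in>\<M>_plus. N (of_M_plus (\<lambda>x. ennreal a * f x)) = ennreal a * N (of_M_plus f)) \<and>
     (\<forall>f\<in>\<M>_plus. N (of_M_plus f) = 0 \<longleftrightarrow> (AE x in half_line. f x = 0)) \<and>
     (\<exists>C\<ge>1. \<forall>f\<in>\<M>_plus. \<forall>g\<in>\<M>_plus.
        N (of_M_plus (\<lambda>x. f x + g x)) \<le> ennreal C * (N (of_M_plus f) + N (of_M_plus g))) \<and>
     \<comment> \<open>(P2)\<close>
     (\<forall>f\<in>\<M>_plus. \<forall>g\<in>\<M>_plus. (AE x in half_line. f x \<le> g x) \<longrightarrow>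
        N (of_M_plus f) \<le> N (of_M_plus g)) \<and>
     \<comment> \<open>(P3)\<close>
     (\<forall>F f. (\<forall>n::nat. F n \<in> \<M>_plus) \<and> f \<in> \<M>_plus \<and>
        (AE x in half_line. incseq (\<lambda>n. F n x) \<and> (\<lambda>n. F n x) \<longlonglongrightarrow> f x) \<longrightarrow>
        incseq (\<lambda>n. N (of_M_plus (F n))) \<and>
        (\<lambda>n. N (of_M_plus (F n))) \<longlonglongrightarrow> N (of_M_plus f)) \<and>
     \<comment> \<open>(P4)\<close>
     (\<forall>E\<in>sets half_line. emeasure half_line E < \<infinity> \<longrightarrow> N (of_M_plus (indicator E)) < \<infinity>)"

definition rearrangement_invariant :: "((real \<Rightarrow> ecomplex) \<Rightarrow> ennreal) \<Rightarrow> bool" where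
  "rearrangement_invariant N \<longleftrightarrow>
     (\<forall>f\<in>\<M>. \<forall>g\<in>\<M>. (\<forall>t\<ge>0. rearrangement f t = rearrangement g t) \<longrightarrow> N f = N g)"

definition HLP_principle :: "((real \<Rightarrow> ecomplex) \<Rightarrow> ennreal) \<Rightarrow> bool" where
  "HLP_principle N \<longleftrightarrow>
     (\<forall>f\<in>\<M>. \<forall>g\<in>\<M>.
        (\<forall>t>0. (\<integral>\<^sup>+s\<in>{0..t}. rearrangement f s \<partial>half_line)
              \<le> (\<integral>\<^sup>+s\<in>{0..t}. rearrangement g s \<partial>half_line)) \<longrightarrow> N f \<le> N g)"

definition L1_norm :: "(real \<Rightarrow> ecomplex) \<Rightarrow> ennreal" where
  "L1_norm f = (\<integral>\<^sup>+x. emod (f x) \<partial>half_line)"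

definition global_component_stronger ::
    "((real \<Rightarrow> ecomplex) \<Rightarrow> ennreal) \<Rightarrow> ((real \<Rightarrow> ecomplex) \<Rightarrow> ennreal) \<Rightarrow> bool" where
  "global_component_stronger N N' \<longleftrightarrow>
     (\<forall>f\<in>\<M>. rearrangement f 1 < \<infinity> \<longrightarrow>
        N (of_M_plus (\<lambda>t. rearrangement f t * indicator {1<..} t)) < \<infinity> \<longrightarrow>
        N' (of_M_plus (\<lambda>t. rearrangement f t * indicator {1<..} t)) < \<infinity>)"

lemma emod_ecomplex_of_ennreal [simp]: "emod (ecomplex_of_ennreal r) = r"
  by (auto simp: emod_def ecomplex_of_ennreal_def less_top)

lemma sets_ecomplex_borel:
  "sets ecomplex_borel = sigma_sets UNIV {U. openin (Alexandroff_compactification euclidean) U}"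
  and space_ecomplex_borel [simp]: "space ecomplex_borel = UNIV"
  by (simp_all add: ecomplex_borel_def)

lemma emod_measurable [measurable]: "emod \<in> borel_measurable ecomplex_borel"
proof (rule borel_measurableI_greater)
  fix y :: ennreal
  have "openin (Alexandroff_compactification euclidean) {x. y < emod x}"
  proof (cases "y = \<infinity>")
    case True
    then have "{x. y < emod x} = Some ` {}" by auto
    then show ?thesis by (metis openin_empty image_empty)
  next
    case False
    then obtain r where r: "y = ennreal r" "r \<ge> 0" by (cases y) auto
    have "{x. y < emod x} = insert None (Some ` (topspace euclidean - cball (0::complex) r))"
    proof (rule set_eqI)
      fix x :: ecomplex
      show "x \<in> {x. y < emod x} \<longleftrightarrow>
            x \<in> insert None (Some ` (topspace euclidean - cball (0::complex) r))"
        using r by (cases x) (auto simp: emod_def ennreal_less_iff)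
    qed
    moreover have "compactin euclidean (cball (0::complex) r)" "closedin euclidean (cball (0::complex) r)"
      by (auto simp: compactin_euclidean_iff)
    ultimately show ?thesis
      unfolding openin_Alexandroff_compactification by blast
  qed
  then show "{x \<in> space ecomplex_borel. y < emod x} \<in> sets ecomplex_borel"
    by (auto simp: sets_ecomplex_borel)
qed

lemma ecomplex_of_ennreal_measurable [measurable]: "ecomplex_of_ennreal \<in> borel \<rightarrow>\<^sub>M ecomplex_borel"
  unfolding ecomplex_borel_def
proof (rule measurable_measure_of)
  fix V :: "ecomplex set"
  assume V: "V \<in> {U. openin (Alexandroff_compactification euclidean) U}"
  have "open {w. Some w \<in> V}"
    using openin_continuous_map_preimage[OF continuous_map_Some, of euclidean V] V by simp
  then have W: "{w. Some w \<in> V} \<in> sets borel"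
    by simp
  have "{r. r \<noteq> \<infinity> \<and> complex_of_real (enn2real r) \<in> {w. Some w \<in> V}} \<in> sets borel"
    using W by measurable
  moreover have "{r::ennreal. r = \<infinity> \<and> None \<in> V} \<in> sets borel"
    by (cases "None \<in> V") auto
  ultimately have "{r. r \<noteq> \<infinity> \<and> complex_of_real (enn2real r) \<in> {w. Some w \<in> V}} \<union>
      {r::ennreal. r = \<infinity> \<and> None \<in> V} \<in> sets borel"
    by (rule sets.Un)
  also have "{r. r \<noteq> \<infinity> \<and> complex_of_real (enn2real r) \<in> {w. Some w \<in> V}} \<union>
      {r::ennreal. r = \<infinity> \<and> None \<in> V} = ecomplex_of_ennreal -` V \<inter> space borel"
    by (auto simp: ecomplex_of_ennreal_def split: if_splits)
  finally show "ecomplex_of_ennreal -` V \<inter> space borel \<in> sets borel" .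
qed auto

lemma of_M_plus_in_M: "g \<in> \<M>_plus \<Longrightarrow> of_M_plus g \<in> \<M>"
  unfolding \<M>_def \<M>_plus_def of_M_plus_def by measurable

lemma emod_in_M_plus: "f \<in> \<M> \<Longrightarrow> (\<lambda>x. emod (f x)) \<in> \<M>_plus"
  unfolding \<M>_def \<M>_plus_def by measurable

lemma quasi_Banach_function_norm_cong_AE:
  assumes N: "quasi_Banach_function_norm N" and "f \<in> \<M>" "g \<in> \<M>"
    and eq: "AE x in half_line. f x = g x"
  shows "N f = N g"
proof -
  have le: "N f \<le> N g" if "f \<in> \<M>" "g \<in> \<M>" "AE x in half_line. f x = g x" for f g
  proof -
    have "AE x in half_line. emod (f x) \<le> emod (g x)"
      using that(3) by eventually_elim simp
    moreover have "\<forall>f\<in>\<M>_plus. \<forall>g\<in>\<M>_plus. (AE x in half_line. f x \<le> g x) \<longrightarrow>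
        N (of_M_plus f) \<le> N (of_M_plus g)"
      using N unfolding quasi_Banach_function_norm_def by (elim conjE)
    ultimately have "N (of_M_plus (\<lambda>x. emod (f x))) \<le> N (of_M_plus (\<lambda>x. emod (g x)))"
      using emod_in_M_plus[OF that(1)] emod_in_M_plus[OF that(2)] by simp
    moreover have "\<forall>f\<in>\<M>. N (of_M_plus (\<lambda>x. emod (f x))) = N f"
      using N unfolding quasi_Banach_function_norm_def by (elim conjE)
    ultimately show ?thesis
      using that(1,2) by simp
  qed
  have "AE x in half_line. g x = f x"
    using eq by eventually_elim simp
  then show ?thesis
    using le assms by (intro antisym) auto
qed

end

theory Submission
  imports Defs
begin

text \<open>Put \<open>h = f\<^sup>* \<chi>\<^bsub>(1,\<infinity>)\<^esub>\<close>. Since \<open>h\<^sup>*(t) \<le> f\<^sup>*(t + 1)\<close>, the integral of \<open>h\<^sup>*\<close> over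
  \<open>[0,t]\<close> is at most both \<open>t f\<^sup>*(1)\<close> and \<open>\<parallel>h\<parallel>\<close> in \<open>L\<^sup>1\<close>, hence at most \<open>K min(t,1)\<close> with
  \<open>K = f\<^sup>*(1) + \<parallel>h\<parallel>\<close>. The last expression is the integral of the rearrangement of \<open>K \<chi>\<^bsub>[0,1]\<^esub>\<close>, a
  function of finite norm, which therefore dominates \<open>h\<close> by the Hardy--Littlewood--Polya principle.\<close>

lemma rearrangement_antimono: "antimono (rearrangement f)"
proof (rule antimonoI)
  fix s t :: real
  assume "s \<le> t"
  then show "rearrangement f t \<le> rearrangement f s"
    unfolding rearrangement_def by (intro Inf_superset_mono) (blast intro: order_trans ennreal_leI)
qed

lemma borel_measurable_antimono_ennreal:
  fixes f :: "real \<Rightarrow> ennreal"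
  assumes "antimono f"
  shows "f \<in> borel_measurable borel"
proof (rule borel_measurableI_greater)
  fix y
  have "is_interval {x. y < f x}"
    using antimonoD[OF assms] by (auto simp: is_interval_1 intro: less_le_trans)
  then show "{x \<in> space borel. y < f x} \<in> sets borel"
    using real_interval_borel_measurable by simp
qed

lemma rearrangement_measurable [measurable]: "rearrangement f \<in> borel_measurable borel"
  by (rule borel_measurable_antimono_ennreal[OF rearrangement_antimono])

lemma borel_measurable_in_M_plus: "g \<in> borel_measurable borel \<Longrightarrow> g \<in> \<M>_plus"
  unfolding \<M>_plus_def by (intro measurable_restrict_space1 measurable_completion) simp

text \<open>Translation and the nullity of points are available for \<open>lborel\<close>, so
  integrals of Borel functions are moved there.\<close>

lemma nn_integral_half_line:
  assumes "g \<in> borel_measurable borel"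
  shows "(\<integral>\<^sup>+x. g x \<partial>half_line) = (\<integral>\<^sup>+x. g x * indicator {0..} x \<partial>lborel)"
  using assms by (simp add: nn_integral_restrict_space nn_integral_completion)

lemma emeasure_half_line:
  "E \<in> sets borel \<Longrightarrow> E \<subseteq> {0..} \<Longrightarrow> emeasure half_line E = emeasure lborel E"
  by (simp add: emeasure_restrict_space)

text \<open>Points where the truncated function exceeds its level at \<open>t + 1\<close> lie
  between 1 and \<open>t + 1\<close>, a set of measure \<open>t\<close>. Hence that level is
  admissible in the infimum at \<open>t\<close>.\<close>

lemma rearrangement_tail_le:
  assumes "rearrangement f 1 < \<infinity>" "0 \<le> t"
  shows "rearrangement (of_M_plus (\<lambda>x. rearrangement f x * indicator {1<..} x)) t
           \<le> rearrangement f (t + 1)"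
proof -
  have "rearrangement f (t + 1) \<le> rearrangement f 1"
    using antimonoD[OF rearrangement_antimono] assms by simp
  with assms(1) have fin: "rearrangement f (t + 1) < \<infinity>"
    by (rule order.strict_trans1[rotated])
  \<comment> \<open>The infimum runs over real levels only, so the finite value at
    \<open>t + 1\<close> is turned into a real number.\<close>
  define s where "s = enn2real (rearrangement f (t + 1))"
  have s: "0 \<le> s" "ennreal s = rearrangement f (t + 1)"
    using fin by (auto simp: s_def)
  let ?h = "of_M_plus (\<lambda>x. rearrangement f x * indicator {1<..} x)"
  let ?E = "{x \<in> space half_line. emod (?h x) > ennreal s}"
  have "x < t + 1" if "rearrangement f (t + 1) < rearrangement f x" for x
    using that antimonoD[OF rearrangement_antimono, of "t + 1" x f] by (meson leD not_le)
  then have "?E \<subseteq> {1..t + 1}"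
    using s by (auto simp: of_M_plus_def indicator_def less_imp_le split: if_splits)
  then have "emeasure half_line ?E \<le> emeasure half_line {1..t + 1}"
    by (rule emeasure_mono) (simp add: sets_restrict_space_iff)
  also have "\<dots> = ennreal t"
    using assms by (subst emeasure_half_line) auto
  finally show ?thesis
    using s unfolding rearrangement_def[of ?h] by (intro Inf_lower) (use s in force)
qed

text \<open>Integrating the pointwise bound and shifting by 1 gives the integral of
  \<open>rearrangement f\<close> beyond 1, a bound independent of \<open>t\<close>.\<close>

lemma nn_integral_rearrangement_tail_le:
  assumes "rearrangement f 1 < \<infinity>"
  defines "h \<equiv> of_M_plus (\<lambda>x. rearrangement f x * indicator {1<..} x)"
  shows "(\<integral>\<^sup>+s\<in>{0..t}. rearrangement h s \<partial>half_line) \<le> L1_norm h"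
proof -
  have "(\<integral>\<^sup>+s\<in>{0..t}. rearrangement h s \<partial>half_line)
      \<le> (\<integral>\<^sup>+s. rearrangement f (1 + s) \<partial>half_line)"
    using rearrangement_tail_le[OF assms(1)] unfolding h_def
    by (intro nn_integral_mono) (auto simp: indicator_def add.commute)
  \<comment> \<open>The restriction to nonnegative \<open>s\<close> is written in terms of
    \<open>1 + s\<close>, ready for the translation.\<close>
  also have "\<dots> = (\<integral>\<^sup>+s. rearrangement f (1 + s) * indicator {1..} (1 + s) \<partial>lborel)"
    by (subst nn_integral_half_line) (auto intro!: nn_integral_cong simp: indicator_def)
  also have "\<dots> = (\<integral>\<^sup>+s. rearrangement f s * indicator {1..} s \<partial>lborel)"
    using nn_integral_real_affine[of "\<lambda>s. rearrangement f s * indicator {1..} s" 1 1] by simp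
  \<comment> \<open>The two truncations differ only at the null point 1.\<close>
  also have "\<dots> = (\<integral>\<^sup>+s. rearrangement f s * indicator {1<..} s * indicator {0..} s \<partial>lborel)"
    by (intro nn_integral_cong_AE, use AE_lborel_singleton[of 1] in eventually_elim)
       (auto simp: indicator_def)
  also have "\<dots> = L1_norm h"
    unfolding L1_norm_def h_def of_M_plus_def
    by (subst nn_integral_half_line) auto
  finally show ?thesis .
qed

text \<open>A level below \<open>K\<close> is exceeded on all of \<open>{0..1}\<close>, whose
  measure 1 is larger than \<open>t\<close>, so it is not admissible. At \<open>t = 1\<close> the
  rearrangement already drops to 0.\<close>

lemma rearrangement_indicator_ge:
  assumes "0 \<le> t" "t < 1"
  shows "ennreal K \<le> rearrangement (of_M_plus (\<lambda>x. ennreal K * indicator {0..1} x)) t"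
  unfolding rearrangement_def
proof (rule Inf_greatest, clarify)
  fix s :: real
  let ?E = "{x \<in> space half_line. ennreal s < emod (of_M_plus (\<lambda>x. ennreal K * indicator {0..1} x) x)}"
  assume s: "emeasure half_line ?E \<le> ennreal t"
  show "ennreal K \<le> ennreal s"
  proof (rule ccontr)
    assume "\<not> ennreal K \<le> ennreal s"
    then have "?E = {0..1}"
      by (auto simp: of_M_plus_def indicator_def split: if_splits)
    then have "emeasure half_line ?E = 1"
      by (simp add: emeasure_half_line)
    with s have "ennreal 1 \<le> ennreal t" by simp
    with assms show False by simp
  qed
qed

theorem theorem5p9:
  fixes A :: "(real \<Rightarrow> ecomplex) \<Rightarrow> ennreal"
  assumes "quasi_Banach_function_norm A"
    and "rearrangement_invariant A"
    and "HLP_principle A"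
  shows "global_component_stronger L1_norm A"
  unfolding global_component_stronger_def
proof (intro ballI impI)
  fix f
  let ?h = "of_M_plus (\<lambda>t. rearrangement f t * indicator {1<..} t)"
  assume c: "rearrangement f 1 < \<infinity>" and I: "L1_norm ?h < \<infinity>"
  \<comment> \<open>The finite sum is taken as a real number because homogeneity of \<open>A\<close>
    is stated for real scalars.\<close>
  obtain K where K: "0 \<le> K" "rearrangement f 1 + L1_norm ?h = ennreal K"
    using c I by (metis ennreal_add_less_top ennreal_cases infinity_ennreal_def less_irrefl)
  let ?g = "of_M_plus (\<lambda>x. ennreal K * indicator {0..1} x)"
  have le: "rearrangement f 1 \<le> ennreal K" "L1_norm ?h \<le> ennreal K"
    by (simp_all flip: K(2))
  have "A ?h \<le> A ?g"
  proof (rule assms(3)[unfolded HLP_principle_def, rule_format])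
    fix t :: real
    assume "0 < t"
    let ?r = "min t 1"
    have "(\<integral>\<^sup>+s\<in>{0..t}. rearrangement ?h s \<partial>half_line) \<le> ennreal K * ennreal ?r"
    \<comment> \<open>For small \<open>t\<close> the pointwise bound by
      \<open>rearrangement f 1\<close> suffices; beyond 1 the total mass takes over.\<close>
    proof (cases "t \<le> 1")
      case True
      have "rearrangement ?h s \<le> ennreal K" if "0 \<le> s" for s
        using rearrangement_tail_le[OF c that] antimonoD[OF rearrangement_antimono, of 1 "s + 1" f]
          that le(1) by simp
      then have "(\<integral>\<^sup>+s\<in>{0..t}. rearrangement ?h s \<partial>half_line)
          \<le> (\<integral>\<^sup>+s. ennreal K * indicator {0..t} s \<partial>half_line)"
        by (intro nn_integral_mono) (auto simp: indicator_def)
      also have "\<dots> = ennreal K * ennreal ?r"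
        using True \<open>0 < t\<close>
        by (subst nn_integral_cmult_indicator)
           (auto simp: emeasure_half_line sets_restrict_space_iff)
      finally show ?thesis .
    next
      case False
      then show ?thesis
        using order_trans[OF nn_integral_rearrangement_tail_le[OF c] le(2)] by simp
    qed
    \<comment> \<open>The right endpoint is left out, at no cost in measure, since the lower bound
      for the rearrangement of \<open>?g\<close> holds only below 1.\<close>
    also have "\<dots> = (\<integral>\<^sup>+s. ennreal K * indicator {0..<?r} s \<partial>half_line)"
      using \<open>0 < t\<close> emeasure_half_line[of "{0..<?r}"]
      by (subst nn_integral_cmult_indicator)
         (auto simp: sets_restrict_space_iff subset_iff)
    also have "\<dots> \<le> (\<integral>\<^sup>+s\<in>{0..t}. rearrangement ?g s \<partial>half_line)"
      using rearrangement_indicator_ge by (intro nn_integral_mono) (auto simp: indicator_def)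
    finally show "(\<integral>\<^sup>+s\<in>{0..t}. rearrangement ?h s \<partial>half_line)
        \<le> (\<integral>\<^sup>+s\<in>{0..t}. rearrangement ?g s \<partial>half_line)" .
  qed (auto intro!: of_M_plus_in_M borel_measurable_in_M_plus)
  \<comment> \<open>Homogeneity in (Q1) extracts \<open>K\<close>; (P4) then makes the norm of the
    indicator finite.\<close>
  also have "A ?g = ennreal K * A (of_M_plus (indicator {0..1}))"
  proof -
    have "\<forall>a\<ge>0. \<forall>f\<in>\<M>_plus. A (of_M_plus (\<lambda>x. ennreal a * f x)) = ennreal a * A (of_M_plus f)"
      using assms(1) unfolding quasi_Banach_function_norm_def by (elim conjE)
    then show ?thesis
      using K(1) borel_measurable_in_M_plus[of "indicator {0..1}"] by simp
  qed
  also have "\<dots> < \<infinity>"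
  proof -
    have "\<forall>E\<in>sets half_line. emeasure half_line E < \<infinity> \<longrightarrow> A (of_M_plus (indicator E)) < \<infinity>"
      using assms(1) unfolding quasi_Banach_function_norm_def by (elim conjE)
    moreover have "{0..1} \<in> sets half_line" "emeasure half_line {0..1::real} < \<infinity>"
      by (auto simp: emeasure_half_line sets_restrict_space_iff)
    ultimately show ?thesis
      by (simp add: ennreal_mult_less_top)
  qed
  finally show "A ?h < \<infinity>" .
qed

end
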